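(* Let $\lambda\in\mathbb{R}$ and $f_\lambda(z)=\lambda+z+\tan z$. Then the Fatou set of $f_\lambda$ is the union of two completely invariant Baker domains, namely the upper half-plane $\{z:\Im(z)>0\}$ and the lower half-plane $\{z:\Im(z)<0\}$, and the Julia set of $f_\lambda$ is the extended real line $\mathbb{R}\cup\{\infty\}$.
   Context: For a transcendental meromorphic function $f:\mathbb{C}\to\widehat{\mathbb{C}}$, the Fatou set $\mathcal{F}(f)$ is the set of points having a neighborhood on which all iterates $f^n$, $n>0$, are defined and form a normal family; the Julia set is its complement in $\widehat{\mathbb{C}}$. A Fatou component is a maximal connected subset of $\mathcal{F}(f)$. A Fatou component $U$ is invariant if $f(U)\subseteq U$, and completely invariant if moreover $f^{-1}(U)\subseteq U$. An invariant Fatou component $U$ is a Baker domain if $f^n\to\infty$ uniformly on every compact subset of $U$. *)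

theory Defs
  imports "HOL-Complex_Analysis.Complex_Analysis"
begin

datatype riemann_sphere = Fin complex | Infty

text \<open>
  The Riemann sphere carries the chordal metric, i.e. the Euclidean metric of
  \<open>\<complex> \<times> \<real>\<close> pulled back along inverse stereographic projection.
\<close>

fun inv_stereographic :: "riemann_sphere \<Rightarrow> complex \<times> real" where
  "inv_stereographic (Fin z) =
     (2 * z / complex_of_real (1 + (cmod z)\<^sup>2), ((cmod z)\<^sup>2 - 1) / ((cmod z)\<^sup>2 + 1))"
| "inv_stereographic Infty = (0, 1)"

lemma inj_inv_stereographic: "inj inv_stereographic"
proof (rule injI)
  fix v w :: riemann_sphere
  assume eq: "inv_stereographic v = inv_stereographic w"
  have pos: "1 + (cmod z)\<^sup>2 > 0" for z
    by (simp add: add_pos_nonneg)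
  have ne: "((cmod z)\<^sup>2 - 1) / ((cmod z)\<^sup>2 + 1) \<noteq> 1" for z
    using pos[of z] by (simp add: field_simps)
  show "v = w"
  proof (cases v; cases w)
    fix a b assume v: "v = Fin a" and w: "w = Fin b"
    have "((cmod a)\<^sup>2 - 1) / ((cmod a)\<^sup>2 + 1) = ((cmod b)\<^sup>2 - 1) / ((cmod b)\<^sup>2 + 1)"
      using eq v w by simp
    hence sq: "(cmod a)\<^sup>2 = (cmod b)\<^sup>2"
      using pos[of a] pos[of b] by (simp add: field_simps)
    have "complex_of_real (1 + (cmod b)\<^sup>2) \<noteq> 0"
      using pos[of b] by (simp only: of_real_eq_0_iff)
    moreover have "2 * a / complex_of_real (1 + (cmod b)\<^sup>2) = 2 * b / complex_of_real (1 + (cmod b)\<^sup>2)"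
      using eq v w sq by simp
    ultimately have "a = b" by (simp del: of_real_add)
    thus ?thesis using v w by simp
  qed (use eq ne in \<open>auto dest: sym\<close>)
qed

instantiation riemann_sphere :: metric_space
begin

definition dist_riemann_sphere :: "riemann_sphere \<Rightarrow> riemann_sphere \<Rightarrow> real" where
  "dist_riemann_sphere v w = dist (inv_stereographic v) (inv_stereographic w)"

definition uniformity_riemann_sphere :: "(riemann_sphere \<times> riemann_sphere) filter" where
  "uniformity_riemann_sphere = (INF e\<in>{0<..}. principal {(v, w). dist v w < e})"

definition open_riemann_sphere :: "riemann_sphere set \<Rightarrow> bool" where
  "open_riemann_sphere U \<longleftrightarrow> (\<forall>w\<in>U. \<forall>\<^sub>F (w', v) in uniformity. w' = w \<longrightarrow> v \<in> U)"

instance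
proof
  fix u v w :: riemann_sphere
  show "dist v w = 0 \<longleftrightarrow> v = w"
    using inj_inv_stereographic by (auto simp: dist_riemann_sphere_def dest: injD)
  show "dist v w \<le> dist v u + dist w u"
    unfolding dist_riemann_sphere_def by (rule dist_triangle2)
qed (rule uniformity_riemann_sphere_def open_riemann_sphere_def)+

end

text \<open>
  A meromorphic function given by its finite values, read as a map into the sphere.
  A value \<open>g z\<close> that the library assigns at a pole (e.g. \<open>tan (pi/2) = 0\<close>) is discarded.
\<close>

definition sphere_map :: "(complex \<Rightarrow> complex) \<Rightarrow> complex \<Rightarrow> riemann_sphere" where
  "sphere_map g z = (if is_pole g z then Infty else Fin (g z))"

text \<open>
  \<open>iterate f n w\<close> is meaningful only if \<open>iterate_defined f n w\<close>; the value
  \<open>Infty\<close> used for \<open>f\<close> at infinity, where \<open>f\<close> is undefined, is a dummy.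
\<close>

primrec iterate :: "(complex \<Rightarrow> riemann_sphere) \<Rightarrow> nat \<Rightarrow> riemann_sphere \<Rightarrow> riemann_sphere" where
  "iterate f 0 w = w"
| "iterate f (Suc n) w = (case iterate f n w of Fin z \<Rightarrow> f z | Infty \<Rightarrow> Infty)"

definition iterate_defined :: "(complex \<Rightarrow> riemann_sphere) \<Rightarrow> nat \<Rightarrow> riemann_sphere \<Rightarrow> bool" where
  "iterate_defined f n w \<longleftrightarrow> (\<forall>k<n. iterate f k w \<noteq> Infty)"

definition normal_family_on ::
    "riemann_sphere set \<Rightarrow> (riemann_sphere \<Rightarrow> riemann_sphere) set \<Rightarrow> bool" where
  "normal_family_on U \<F> \<longleftrightarrow>
     (\<forall>h :: nat \<Rightarrow> riemann_sphere \<Rightarrow> riemann_sphere. range h \<subseteq> \<F> \<longrightarrow>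
        (\<exists>r g. strict_mono r \<and>
           (\<forall>K. compact K \<and> K \<subseteq> U \<longrightarrow> uniform_limit K (\<lambda>n. h (r n)) g sequentially)))"

definition Fatou_set :: "(complex \<Rightarrow> riemann_sphere) \<Rightarrow> riemann_sphere set" where
  "Fatou_set f = {w. \<exists>U. open U \<and> w \<in> U \<and>
      (\<forall>n>0. \<forall>u\<in>U. iterate_defined f n u) \<and> normal_family_on U {iterate f n |n. n > 0}}"

definition Julia_set :: "(complex \<Rightarrow> riemann_sphere) \<Rightarrow> riemann_sphere set" where
  "Julia_set f = - Fatou_set f"

definition Fatou_component :: "(complex \<Rightarrow> riemann_sphere) \<Rightarrow> riemann_sphere set \<Rightarrow> bool" where
  "Fatou_component f U \<longleftrightarrow> U \<in> components (Fatou_set f)"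

definition invariant_Fatou_component :: "(complex \<Rightarrow> riemann_sphere) \<Rightarrow> riemann_sphere set \<Rightarrow> bool" where
  "invariant_Fatou_component f U \<longleftrightarrow> Fatou_component f U \<and> f ` (Fin -` U) \<subseteq> U"

definition completely_invariant_Fatou_component ::
    "(complex \<Rightarrow> riemann_sphere) \<Rightarrow> riemann_sphere set \<Rightarrow> bool" where
  "completely_invariant_Fatou_component f U \<longleftrightarrow>
     invariant_Fatou_component f U \<and> Fin ` (f -` U) \<subseteq> U"

definition Baker_domain :: "(complex \<Rightarrow> riemann_sphere) \<Rightarrow> riemann_sphere set \<Rightarrow> bool" where
  "Baker_domain f U \<longleftrightarrow> invariant_Fatou_component f U \<and>
     (\<forall>K. compact K \<and> K \<subseteq> U \<longrightarrow> uniform_limit K (iterate f) (\<lambda>_. Infty) sequentially)"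

definition tan_map :: "real \<Rightarrow> complex \<Rightarrow> riemann_sphere" where
  "tan_map l = sphere_map (\<lambda>z. complex_of_real l + z + tan z)"

definition upper_half_plane :: "riemann_sphere set" where
  "upper_half_plane = Fin ` {z. Im z > 0}"

definition lower_half_plane :: "riemann_sphere set" where
  "lower_half_plane = Fin ` {z. Im z < 0}"

end

theory Submission
  imports Defs
begin

text \<open>
  Since \<open>Im (tan z) \<ge> tanh (Im z)\<close> on the upper half-plane and \<open>tan\<close> is odd, every application of
  the map pushes a point with \<open>\<bar>Im z\<bar> \<ge> m\<close> away from the real line by at least \<open>tanh m\<close>. Hence the
  iterates tend to \<open>\<infinity>\<close> locally uniformly on both half-planes. On the real line the derivative
  \<open>1 + 1 / cos\<^sup>2 x\<close> is at least 2, so an interval on which all iterates were finite would have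
  images of length at least \<open>2\<^sup>n\<close> times its own that avoid the zeros of \<open>cos\<close>, which is absurd:
  every real interval contains a point that is eventually mapped to \<open>\<infinity>\<close>.
\<close>

section \<open>Topology of the Riemann sphere\<close>

lemma continuous_on_inv_stereographic: "continuous_on S inv_stereographic"
  unfolding continuous_on_iff dist_riemann_sphere_def by blast

text \<open>The chordal metric makes \<open>inv_stereographic\<close> an isometry, so continuity of
  \<open>Fin\<close> is that of the coordinate formula, whose denominators never vanish.\<close>

lemma continuous_on_Fin: "continuous_on S Fin"
proof -
  have pos: "1 + (cmod z)\<^sup>2 > 0" for z
    by (simp add: add_pos_nonneg)
  hence "complex_of_real (1 + (cmod z)\<^sup>2) \<noteq> 0" for z
    by (metis of_real_eq_0_iff less_irrefl)
  moreover have "(cmod z)\<^sup>2 + 1 \<noteq> 0" for z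
    using pos[of z] by linarith
  ultimately have "continuous_on S (\<lambda>z. inv_stereographic (Fin z))"
    unfolding inv_stereographic.simps by (intro continuous_intros) auto
  thus ?thesis
    unfolding continuous_on_iff dist_riemann_sphere_def .
qed

text \<open>Stereographic projection, the left inverse of \<open>Fin\<close>; at \<open>Infty\<close> it has the junk value 0.\<close>

definition fin_part :: "riemann_sphere \<Rightarrow> complex" where
  "fin_part w = fst (inv_stereographic w) / of_real (1 - snd (inv_stereographic w))"

lemma one_minus_snd_inv_stereographic_Fin:
  "1 - snd (inv_stereographic (Fin z)) = 2 / (1 + (cmod z)\<^sup>2)"
proof -
  have "1 + (cmod z)\<^sup>2 > 0" by (simp add: add_pos_nonneg)
  thus ?thesis by (simp add: field_simps)
qed

lemma fin_part_Fin [simp]: "fin_part (Fin z) = z"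
proof -
  have "1 + (cmod z)\<^sup>2 > 0"
    by (simp add: add_pos_nonneg)
  hence "complex_of_real (1 + (cmod z)\<^sup>2) \<noteq> 0"
    by (metis of_real_eq_0_iff less_irrefl)
  thus ?thesis
    unfolding fin_part_def one_minus_snd_inv_stereographic_Fin
    by (simp add: field_simps del: of_real_add)
qed

lemma continuous_on_fin_part: "continuous_on (- {Infty}) fin_part"
proof -
  have "complex_of_real (1 - snd (inv_stereographic w)) \<noteq> 0" if w: "w \<noteq> Infty" for w
  proof -
    obtain z where "w = Fin z"
      using w by (cases w) auto
    moreover have "1 + (cmod z)\<^sup>2 > 0" by (simp add: add_pos_nonneg)
    ultimately show ?thesis
      by (simp only: one_minus_snd_inv_stereographic_Fin of_real_eq_0_iff) simp
  qed
  thus ?thesis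
    unfolding fin_part_def
    by (intro continuous_intros continuous_on_inv_stereographic) auto
qed

text \<open>Away from \<open>Infty\<close> the image is the preimage of \<open>S\<close> under the
  continuous left inverse \<open>fin_part\<close>. Intersecting with \<open>- {Infty}\<close> guards
  against the junk value, since \<open>S\<close> may contain 0.\<close>

lemma open_Fin_image:
  assumes "open S"
  shows "open (Fin ` S)"
proof -
  have "w \<in> Fin ` S" if "w \<noteq> Infty" "fin_part w \<in> S" for w
    using that by (cases w) auto
  hence "Fin ` S = - {Infty} \<inter> fin_part -` S"
    by auto
  thus ?thesis
    using continuous_on_fin_part assms by (simp add: continuous_on_open_vimage open_Compl Int_commute)
qed

text \<open>The exact value is 2 / sqrt (1 + r^2) with r = \<open>cmod z\<close>. The cruder bound,
  2 / r from each of the two coordinates, still gives convergence to \<open>Infty\<close> as r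
  grows.\<close>

lemma dist_Fin_Infty_le:
  assumes "z \<noteq> 0"
  shows "dist (Fin z) Infty \<le> 4 / cmod z"
proof -
  define r where "r = cmod z"
  have r: "r > 0" using assms by (simp add: r_def)
  have p: "1 + r\<^sup>2 > 0" by (simp add: add_pos_nonneg)
  have le: "1 + r\<^sup>2 \<ge> r"
    using sum_squares_bound[of 1 r] r by simp
  have "cmod (complex_of_real (1 + r\<^sup>2)) = 1 + r\<^sup>2"
    using p by (metis abs_of_pos norm_of_real)
  hence 1: "norm (2 * z / complex_of_real (1 + (cmod z)\<^sup>2)) = 2 * r / (1 + r\<^sup>2)"
    by (simp add: norm_divide norm_mult r_def del: of_real_add)
  have "((cmod z)\<^sup>2 - 1) / ((cmod z)\<^sup>2 + 1) - 1 = - (2 / (1 + r\<^sup>2))"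
    using p by (simp add: r_def[symmetric] field_simps)
  hence 2: "norm (((cmod z)\<^sup>2 - 1) / ((cmod z)\<^sup>2 + 1) - 1) = 2 / (1 + r\<^sup>2)"
    using p by simp
  have "dist (Fin z) Infty = norm (2 * z / complex_of_real (1 + (cmod z)\<^sup>2),
      ((cmod z)\<^sup>2 - 1) / ((cmod z)\<^sup>2 + 1) - 1)"
    by (simp add: dist_riemann_sphere_def dist_norm)
  also have "\<dots> \<le> 2 * r / (1 + r\<^sup>2) + 2 / (1 + r\<^sup>2)"
    using norm_Pair_le[of "2 * z / complex_of_real (1 + (cmod z)\<^sup>2)"
        "((cmod z)\<^sup>2 - 1) / ((cmod z)\<^sup>2 + 1) - 1"] unfolding 1 2 .
  also have "2 * r / (1 + r\<^sup>2) \<le> 2 / r"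
    using r p by (simp add: divide_simps power2_eq_square)
  also have "2 / (1 + r\<^sup>2) \<le> 2 / r"
    using r le by (intro divide_left_mono) auto
  finally show ?thesis by (simp add: r_def)
qed

section \<open>Iterates\<close>

lemma iterate_Infty [simp]: "iterate f n Infty = Infty"
  by (induction n) auto

lemma iterate_add: "iterate f (m + n) w = iterate f m (iterate f n w)"
  by (induction m) auto

text \<open>\<open>iterate_defined f n\<close> inspects only indices below \<open>n\<close>, so
  finiteness of the \<open>n\<close>-th iterate comes from the instance \<open>Suc n\<close>, which
  is also positive.\<close>

lemma iterate_defined_always_iff:
  "(\<forall>n>0. iterate_defined f n w) \<longleftrightarrow> (\<forall>n. iterate f n w \<noteq> Infty)"
  unfolding iterate_defined_def by (metis lessI zero_less_Suc)

lemma Fatou_set_iterate_finite: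
  assumes "w \<in> Fatou_set f"
  obtains U where "open U" "w \<in> U" "\<And>u n. u \<in> U \<Longrightarrow> iterate f n u \<noteq> Infty"
proof -
  obtain U where U: "open U" "w \<in> U" and fin: "\<forall>n>0. \<forall>u\<in>U. iterate_defined f n u"
    using assms unfolding Fatou_set_def by blast
  have "iterate f n u \<noteq> Infty" if "u \<in> U" for u n
    using fin that iterate_defined_always_iff[of f u] by simp
  thus thesis using U that by blast
qed

lemma Infty_notin_Fatou_set: "Infty \<notin> Fatou_set f"
  using Fatou_set_iterate_finite[of Infty f] iterate_Infty[of f 0] by metis

text \<open>A sequence drawn from the family may list the iterates in any order and with
  repetitions. Either one index recurs infinitely often, giving a constant subsequence, or the
  indices tend to infinity and the whole sequence inherits the limit \<open>g\<close>.\<close>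

lemma normal_family_on_iterates:
  assumes "\<And>K. compact K \<Longrightarrow> K \<subseteq> U \<Longrightarrow> uniform_limit K (iterate f) g sequentially"
  shows "normal_family_on U {iterate f n |n. n > 0}"
  unfolding normal_family_on_def
proof (intro allI impI)
  fix h :: "nat \<Rightarrow> riemann_sphere \<Rightarrow> riemann_sphere"
  assume "range h \<subseteq> {iterate f n |n. n > 0}"
  hence "\<forall>k. \<exists>n. h k = iterate f n" by auto
  then obtain N where N: "\<And>k. h k = iterate f (N k)" by metis
  show "\<exists>r g. strict_mono r \<and>
    (\<forall>K. compact K \<and> K \<subseteq> U \<longrightarrow> uniform_limit K (\<lambda>n. h (r n)) g sequentially)"
  proof (cases "\<exists>m. infinite {k. N k = m}")
    case True
    then obtain m and r :: "nat \<Rightarrow> nat" where "strict_mono r" "\<And>n. N (r n) = m"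
      using infinite_enumerate by blast
    thus ?thesis
      by (intro exI[of _ r] exI[of _ "iterate f m"]) (auto simp: N uniform_limit_iff)
  next
    case False
    have "filterlim N at_top sequentially"
      unfolding filterlim_at_top
    proof
      fix M
      have "{k. \<not> M \<le> N k} = (\<Union>m<M. {k. N k = m})" by auto
      moreover have "finite (\<Union>m<M. {k. N k = m})" using False by blast
      ultimately show "eventually (\<lambda>k. M \<le> N k) sequentially"
        by (simp add: cofinite_eq_sequentially[symmetric] eventually_cofinite)
    qed
    hence "uniform_limit K (\<lambda>k. h k) g sequentially" if "compact K" "K \<subseteq> U" for K
      unfolding N using filterlim_compose[OF assms[OF that]] by blast
    thus ?thesis
      by (intro exI[of _ id] exI[of _ g]) (auto simp: strict_mono_def)
  qed
qed

section \<open>The tangent map\<close>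

lemma cos_eq_0_imp_Real:
  fixes z :: complex
  assumes "cos z = 0"
  shows "z \<in> \<real>"
  using assms unfolding cos_eq_0 by (auto simp: complex_is_Real_iff)

text \<open>Trades the pole condition for an explicit test. At a zero of \<open>cos\<close> the sine
  is nonzero, so writing the function as a quotient over \<open>cos\<close> shows a pole; elsewhere
  the function is analytic.\<close>

lemma tan_map_eq:
  "tan_map l z = (if cos z = 0 then Infty else Fin (of_real l + z + tan z))"
proof (cases "cos z = 0")
  case False
  have "(\<lambda>z. of_real l + z + tan z) analytic_on {z}"
    unfolding tan_def using False by (intro analytic_intros) auto
  hence "\<not> is_pole (\<lambda>z. of_real l + z + tan z) z"
    using not_is_pole_holomorphic analytic_at by blast
  thus ?thesis using False by (simp add: tan_map_def sphere_map_def)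
next
  case True
  have s: "sin z \<noteq> 0"
    using True sin_cos_squared_add[of z] by auto
  \<comment> \<open>Zeros of \<open>cos\<close> are isolated; the point 0, where \<open>cos\<close>
    is 1, witnesses that it does not vanish identically.\<close>
  have nz: "eventually (\<lambda>w. cos w \<noteq> 0) (at z)"
    using non_zero_neighbour_alt[OF holomorphic_on_cos, of UNIV z 0] connected_UNIV by simp
  have "filterlim cos (at 0) (at z)"
    using nz True isCont_cos[of z] by (auto simp: filterlim_at isCont_def)
  hence "filterlim (\<lambda>w. ((of_real l + w) * cos w + sin w) / cos w) at_infinity (at z)"
    using s True by (intro filterlim_divide_at_infinity[of _ "sin z"]) (auto intro!: tendsto_eq_intros)
  moreover have "eventually (\<lambda>w. ((of_real l + w) * cos w + sin w) / cos w =
      of_real l + w + tan w) (at z)"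
    using nz by eventually_elim (simp add: tan_def field_simps)
  ultimately have "is_pole (\<lambda>w. of_real l + w + tan w) z"
    unfolding is_pole_def using filterlim_cong[OF refl refl] by fast
  thus ?thesis using True by (simp add: tan_map_def sphere_map_def)
qed

text \<open>With z = x + iy, the imaginary part of \<open>tan z\<close> is sinh y cosh y / (cos^2 x
  + sinh^2 y). Since cos^2 x is at most 1, the denominator is at most cosh^2 y.\<close>

lemma Im_tan_ge:
  assumes "Im z > 0"
  shows "Im (tan z) \<ge> tanh (Im z)"
proof -
  define x y where "x = Re z" and "y = Im z"
  have y: "y > 0" using assms by (simp add: y_def)
  have e: "exp y + exp (- y) = 2 * cosh y" "exp y - exp (- y) = 2 * sinh y"
    "exp (-y) - exp y = - 2 * sinh y"
    by (auto simp: cosh_def sinh_def)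
  have sp: "sinh y > 0" "cosh y > 0" using y by simp_all
  have den: "(Re (cos z))\<^sup>2 + (Im (cos z))\<^sup>2 = (cos x)\<^sup>2 + (sinh y)\<^sup>2"
  proof -
    have "(Re (cos z))\<^sup>2 + (Im (cos z))\<^sup>2 = (cos x)\<^sup>2 * (cosh y)\<^sup>2 + (sin x)\<^sup>2 * (sinh y)\<^sup>2"
      by (simp add: Re_cos Im_cos e flip: x_def y_def add: power_mult_distrib)
    also have "\<dots> = (cos x)\<^sup>2 + (sinh y)\<^sup>2"
      by (simp add: cosh_square_eq sin_squared_eq algebra_simps)
    finally show ?thesis .
  qed
  have num: "Im (sin z) * Re (cos z) - Re (sin z) * Im (cos z) = sinh y * cosh y"
  proof -
    have "Im (sin z) * Re (cos z) - Re (sin z) * Im (cos z)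
        = cos x * sinh y * (cos x * cosh y) + sin x * cosh y * (sin x * sinh y)"
      by (simp add: Re_cos Im_cos Re_sin Im_sin e flip: x_def y_def)
    also have "\<dots> = ((cos x)\<^sup>2 + (sin x)\<^sup>2) * (sinh y * cosh y)"
      unfolding power2_eq_square by algebra
    finally show ?thesis by simp
  qed
  have "tanh y = sinh y * cosh y / (cosh y)\<^sup>2"
    using sp by (simp add: tanh_def power2_eq_square)
  also have "\<dots> \<le> sinh y * cosh y / ((cos x)\<^sup>2 + (sinh y)\<^sup>2)"
    using sp abs_cos_le_one[of x]
    by (intro divide_left_mono mult_pos_pos)
      (auto simp: cosh_square_eq abs_square_le_1 add_nonneg_pos)
  also have "\<dots> = Im (tan z)"
    by (simp add: tan_def Im_divide num den)
  finally show ?thesis by (simp add: y_def)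
qed

section \<open>The two half-planes\<close>

text \<open>The sign \<open>s\<close> selects the upper (\<open>s = 1\<close>) or the lower (\<open>s = -1\<close>) half-plane.\<close>

definition half_plane :: "real \<Rightarrow> riemann_sphere set" where
  "half_plane s = Fin ` {z. s * Im z > 0}"

lemma upper_half_plane_eq: "upper_half_plane = half_plane 1"
  and lower_half_plane_eq: "lower_half_plane = half_plane (-1)"
  by (simp_all add: upper_half_plane_def lower_half_plane_def half_plane_def)

lemma Fin_in_half_plane_iff [simp]: "Fin z \<in> half_plane s \<longleftrightarrow> s * Im z > 0"
  and Infty_notin_half_plane [simp]: "Infty \<notin> half_plane s"
  by (auto simp: half_plane_def)

lemma open_half_plane: "open (half_plane s)"
  unfolding half_plane_def by (intro open_Fin_image open_Collect_less continuous_intros)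

lemma connected_half_plane: "connected (half_plane s)"
proof -
  have "{z. s * Im z > 0} = {z. inner (Complex 0 s) z > 0}"
    by (simp add: inner_complex_def)
  hence "convex {z. s * Im z > 0}"
    using convex_halfspace_gt[of 0 "Complex 0 s"] by simp
  thus ?thesis
    unfolding half_plane_def
    by (intro connected_continuous_image continuous_on_Fin convex_connected)
qed

lemma tan_map_step:
  assumes s: "s = 1 \<or> s = -1" and z: "s * Im z > 0"
  obtains z' where "tan_map l z = Fin z'" "s * Im z' \<ge> s * Im z + tanh (s * Im z)"
proof
  have "cos z \<noteq> 0"
    using z cos_eq_0_imp_Real[of z] by (auto simp: complex_is_Real_iff)
  thus "tan_map l z = Fin (of_real l + z + tan z)"
    by (simp add: tan_map_eq)
  have "s * Im (tan z) \<ge> tanh (s * Im z)"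
    \<comment> \<open>For s = -1 the bound is applied at \<open>-z\<close>, which lies in the upper
      half-plane, and oddness of \<open>tan\<close> carries it back.\<close>
    using s z Im_tan_ge[of z] Im_tan_ge[of "-z"] by auto
  thus "s * Im (of_real l + z + tan z) \<ge> s * Im z + tanh (s * Im z)"
    by (simp add: algebra_simps)
qed

text \<open>The orbit never drops below height \<open>m\<close>, and \<open>tanh\<close> is
  increasing, so every step gains at least the same amount \<open>tanh m\<close>.\<close>

lemma iterate_tan_map_step:
  assumes s: "s = 1 \<or> s = -1" and m: "m > 0" "s * Im z \<ge> m"
  obtains z' where "iterate (tan_map l) n (Fin z) = Fin z'" "s * Im z' \<ge> m + of_nat n * tanh m"
proof (induction n arbitrary: thesis)
  case 0
  thus ?case using m by auto
next
  case (Suc n)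
  obtain z' where z': "iterate (tan_map l) n (Fin z) = Fin z'" "s * Im z' \<ge> m + of_nat n * tanh m"
    using Suc.IH .
  have "of_nat n * tanh m \<ge> 0" using m by simp
  hence ge: "s * Im z' \<ge> m" using z' by linarith
  hence "s * Im z' > 0" using m by linarith
  then obtain z'' where z'': "tan_map l z' = Fin z''" "s * Im z'' \<ge> s * Im z' + tanh (s * Im z')"
    using tan_map_step[OF s] by blast
  have "tanh (s * Im z') \<ge> tanh m" using ge by simp
  moreover have "of_nat (Suc n) * tanh m = of_nat n * tanh m + tanh m"
    by (simp add: algebra_simps)
  ultimately have "s * Im z'' \<ge> m + of_nat (Suc n) * tanh m"
    using z'(2) z''(2) by linarith
  thus ?case using Suc.prems z' z'' by auto
qed

text \<open>On a compact set the height \<open>s * Im z\<close> attains a positive minimum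
  \<open>m\<close>, so the linear growth of the iterates is uniform over the set.\<close>

lemma uniform_limit_half_plane:
  assumes s: "s = 1 \<or> s = -1" and K: "compact K" "K \<subseteq> half_plane s"
  shows "uniform_limit K (iterate (tan_map l)) (\<lambda>_. Infty) sequentially"
proof (cases "K = {}")
  case False
  have fin: "\<exists>z. w = Fin z \<and> s * Im z > 0" if "w \<in> K" for w
    using that K by (auto simp: half_plane_def)
  have "continuous_on K (\<lambda>w. s * Im (fin_part w))"
    using K by (intro continuous_intros continuous_on_subset[OF continuous_on_fin_part])
      (auto simp: half_plane_def)
  from continuous_attains_inf[OF K(1) False this] obtain w0 where
    w0: "w0 \<in> K" "\<And>w. w \<in> K \<Longrightarrow> s * Im (fin_part w0) \<le> s * Im (fin_part w)" by blast
  define m where "m = s * Im (fin_part w0)"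
  have m: "m > 0" using fin[OF w0(1)] by (auto simp: m_def)
  have t: "tanh m > 0" using m by simp
  show ?thesis
  proof (rule uniform_limitI)
    fix e :: real assume e: "e > 0"
    \<comment> \<open>Chosen so that N * tanh m exceeds 4 / e, the modulus beyond which the chordal
      distance to \<open>Infty\<close> is below e.\<close>
    obtain N :: nat where N: "real N > 4 / (e * tanh m)"
      using reals_Archimedean2 by blast
    show "\<forall>\<^sub>F n in sequentially. \<forall>w\<in>K. dist (iterate (tan_map l) n w) Infty < e"
    proof (intro eventually_sequentiallyI ballI)
      fix n w assume n: "n \<ge> N" and w: "w \<in> K"
      obtain z where z: "w = Fin z" "s * Im z \<ge> m"
        using fin[OF w] w0(2)[OF w] by (auto simp: m_def)
      obtain z' where z': "iterate (tan_map l) n (Fin z) = Fin z'"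
          "s * Im z' \<ge> m + of_nat n * tanh m"
        using iterate_tan_map_step[OF s m z(2)] .
      have "s * Im z' \<le> cmod z'"
        using s abs_Im_le_cmod[of z'] by auto
      moreover have "real N * tanh m \<le> real n * tanh m"
        using n t by (intro mult_right_mono) auto
      moreover have "4 / e < real N * tanh m"
        using N e t by (simp add: field_simps)
      ultimately have big: "4 / e < cmod z'"
        using z' m by linarith
      hence "cmod z' > 0"
        using e by (smt (verit) divide_pos_pos)
      hence "dist (Fin z') Infty \<le> 4 / cmod z'" "4 / cmod z' < e"
        using dist_Fin_Infty_le[of z'] big e by (auto simp: field_simps)
      thus "dist (iterate (tan_map l) n w) Infty < e"
        using z z' by simp
    qed
  qed
qed simp

lemma half_plane_subset_Fatou_set:
  assumes s: "s = 1 \<or> s = -1"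
  shows "half_plane s \<subseteq> Fatou_set (tan_map l)"
proof
  fix w assume w: "w \<in> half_plane s"
  have "iterate (tan_map l) n u \<noteq> Infty" if "u \<in> half_plane s" for n u
  proof -
    obtain z where z: "u = Fin z" "s * Im z > 0"
      using \<open>u \<in> half_plane s\<close> by (auto simp: half_plane_def)
    obtain z' where "iterate (tan_map l) n (Fin z) = Fin z'"
      using iterate_tan_map_step[OF s z(2) order_refl] .
    thus ?thesis using z by simp
  qed
  hence "\<forall>n>0. \<forall>u\<in>half_plane s. iterate_defined (tan_map l) n u"
    by (simp add: iterate_defined_def)
  thus "w \<in> Fatou_set (tan_map l)"
    unfolding Fatou_set_def mem_Collect_eq
    using w open_half_plane normal_family_on_iterates[OF uniform_limit_half_plane[OF s]]
    by (intro exI[of _ "half_plane s"] conjI)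
qed

section \<open>The real line\<close>

text \<open>\<open>cos\<close> has opposite values at \<open>a\<close> and \<open>a + pi\<close>, so
  the intermediate value theorem applies.\<close>

lemma cos_zero_in_interval:
  fixes a b :: real
  assumes "b - a \<ge> pi"
  obtains t where "t \<in> {a..b}" "cos t = 0"
proof -
  have "\<exists>t. a \<le> t \<and> t \<le> a + pi \<and> cos t = 0"
  proof (cases "cos a \<ge> 0")
    case True
    have "continuous_on {a..a + pi} cos" by (intro continuous_intros)
    with True show ?thesis using IVT2'[of cos "a + pi" 0 a] by simp
  next
    case False
    have "continuous_on {a..a + pi} cos" by (intro continuous_intros)
    with False show ?thesis using IVT'[of cos a 0 "a + pi"] by simp
  qed
  thus ?thesis using assms that by force
qed

text \<open>The new interval is [F a, F b] for the real restriction F of the map. Finite orbits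
  exclude poles from [a, b], so the mean value theorem with F' at least 2 gives the length. By the
  intermediate value theorem each point of it is some F v, and its orbit is the tail of the orbit of
  v.\<close>

lemma interval_image_doubles:
  fixes a b l :: real
  assumes ab: "a < b"
    and fin: "\<And>t n. t \<in> {a..b} \<Longrightarrow> iterate (tan_map l) n (Fin (of_real t)) \<noteq> Infty"
  obtains c d where "d - c \<ge> 2 * (b - a)"
    and "\<And>t n. t \<in> {c..d} \<Longrightarrow> iterate (tan_map l) n (Fin (of_real t)) \<noteq> Infty"
proof
  define F where "F = (\<lambda>t::real. l + t + tan t)"
  have cos: "cos t \<noteq> 0" if "t \<in> {a..b}" for t
  proof
    assume "cos t = 0"
    hence "cos (complex_of_real t) = 0" by (simp add: cos_of_real)
    thus False using fin[OF that, of 1] by (simp add: tan_map_eq)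
  qed
  have F: "tan_map l (of_real t) = Fin (of_real (F t))" if "t \<in> {a..b}" for t
    using cos[OF that] by (simp add: tan_map_eq F_def tan_def cos_of_real sin_of_real)
  have der: "(F has_real_derivative 1 + inverse ((cos t)\<^sup>2)) (at t)" if "t \<in> {a..b}" for t
    unfolding F_def using cos[OF that] by (auto intro!: derivative_eq_intros)
  obtain t where t: "a < t" "t < b" "F b - F a = (b - a) * (1 + inverse ((cos t)\<^sup>2))"
    using MVT2[OF ab, of F "\<lambda>t. 1 + inverse ((cos t)\<^sup>2)"] der by auto
  have "(cos t)\<^sup>2 \<le> 1" using abs_cos_le_one[of t] by (simp add: abs_square_le_1)
  hence "1 + inverse ((cos t)\<^sup>2) \<ge> 2"
    using cos[of t] t by (auto intro!: one_le_inverse)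
  hence "(b - a) * 2 \<le> (b - a) * (1 + inverse ((cos t)\<^sup>2))"
    using ab by (intro mult_left_mono) auto
  thus "F b - F a \<ge> 2 * (b - a)"
    using t by linarith
  fix u n assume u: "u \<in> {F a..F b}"
  have "continuous_on {a..b} F"
    using der by (meson DERIV_isCont continuous_at_imp_continuous_on)
  then obtain v where v: "v \<in> {a..b}" "F v = u"
    using IVT'[of F a u b] u ab by auto
  have "iterate (tan_map l) n (Fin (of_real u)) = iterate (tan_map l) (n + 1) (Fin (of_real v))"
    using F[OF v(1)] v by (simp add: iterate_add del: add_Suc_right)
  thus "iterate (tan_map l) n (Fin (of_real u)) \<noteq> Infty"
    using fin[OF v(1), of "n + 1"] by simp
qed

text \<open>Otherwise repeated doubling yields an interval of length at least pi with only finite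
  orbits; it contains a zero of \<open>cos\<close>, whose first iterate is
  \<open>Infty\<close>.\<close>

lemma interval_contains_prepole:
  fixes a b l :: real
  assumes "a < b"
  obtains t n where "t \<in> {a..b}" "iterate (tan_map l) n (Fin (of_real t)) = Infty"
proof (rule ccontr)
  assume "\<not> thesis"
  hence fin: "\<forall>t\<in>{a..b}. \<forall>n. iterate (tan_map l) n (Fin (of_real t)) \<noteq> Infty"
    using that by blast
  have "\<exists>c d. d - c \<ge> 2 ^ k * (b - a) \<and>
      (\<forall>t\<in>{c..d}. \<forall>n. iterate (tan_map l) n (Fin (of_real t)) \<noteq> Infty)" for k
  proof (induction k)
    case 0
    thus ?case using fin by (intro exI[of _ a] exI[of _ b]) auto
  next
    case (Suc k)
    then obtain c d where cd: "d - c \<ge> 2 ^ k * (b - a)"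
      "\<And>t n. t \<in> {c..d} \<Longrightarrow> iterate (tan_map l) n (Fin (of_real t)) \<noteq> Infty" by blast
    have "2 ^ k * (b - a) > 0" using assms by simp
    hence "c < d" using cd by linarith
    then obtain c' d' where
      cd': "d' - c' \<ge> 2 * (d - c)"
      "\<And>t n. t \<in> {c'..d'} \<Longrightarrow> iterate (tan_map l) n (Fin (of_real t)) \<noteq> Infty"
      using interval_image_doubles[OF _ cd(2)] by metis
    have "2 ^ Suc k * (b - a) \<le> d' - c'" using cd cd' by simp
    thus ?case using cd'(2) by blast
  qed
  moreover obtain k :: nat where "2 ^ k > pi / (b - a)"
    using real_arch_pow[of 2 "pi / (b - a)"] by auto
  ultimately obtain c d where "d - c \<ge> pi"
      and cd: "\<And>t n. t \<in> {c..d} \<Longrightarrow> iterate (tan_map l) n (Fin (of_real t)) \<noteq> Infty"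
    using assms by (smt (verit) pos_divide_less_eq)
  then obtain t where t: "t \<in> {c..d}" "cos t = 0"
    using cos_zero_in_interval by blast
  hence "cos (complex_of_real t) = 0" by (simp add: cos_of_real)
  thus False using cd[OF t(1), of 1] by (simp add: tan_map_eq)
qed

text \<open>Any neighborhood of a real point contains a real interval, hence a point eventually
  mapped to \<open>Infty\<close>.\<close>

lemma real_notin_Fatou_set: "Fin (of_real x) \<notin> Fatou_set (tan_map l)"
proof
  assume "Fin (of_real x) \<in> Fatou_set (tan_map l)"
  then obtain U where U: "open U" "Fin (of_real x) \<in> U"
    and fin: "\<And>u n. u \<in> U \<Longrightarrow> iterate (tan_map l) n u \<noteq> Infty"
    by (rule Fatou_set_iterate_finite) blast
  have "continuous_on UNIV (\<lambda>t::real. Fin (of_real t))"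
    by (intro continuous_on_compose2[OF continuous_on_Fin[of UNIV]] continuous_intros) auto
  hence "open ((\<lambda>t::real. Fin (of_real t)) -` U)"
    using U(1) by (rule open_vimage[rotated])
  then obtain e where e: "e > 0" "cball x e \<subseteq> (\<lambda>t::real. Fin (of_real t)) -` U"
    using U(2) by (metis open_contains_cball vimageI)
  obtain t n where "t \<in> {x..x + e}" "iterate (tan_map l) n (Fin (of_real t)) = Infty"
    using interval_contains_prepole[of x "x + e"] e(1) by auto
  moreover from this have "t \<in> cball x e" by (auto simp: dist_real_def)
  ultimately show False using e(2) fin by blast
qed

section \<open>The Fatou and Julia sets\<close>

lemma Fatou_set_tan_map: "Fatou_set (tan_map l) = half_plane 1 \<union> half_plane (-1)"
proof
  show "half_plane 1 \<union> half_plane (-1) \<subseteq> Fatou_set (tan_map l)"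
    using half_plane_subset_Fatou_set by simp
  show "Fatou_set (tan_map l) \<subseteq> half_plane 1 \<union> half_plane (-1)"
  proof
    fix w assume w: "w \<in> Fatou_set (tan_map l)"
    then obtain z where z: "w = Fin z"
      using Infty_notin_Fatou_set by (cases w) auto
    have "Im z \<noteq> 0"
    proof
      assume "Im z = 0"
      hence "z = of_real (Re z)" by (simp add: complex_eq_iff)
      thus False using w real_notin_Fatou_set[of "Re z" l] z by metis
    qed
    thus "w \<in> half_plane 1 \<union> half_plane (-1)" by (auto simp: z)
  qed
qed

lemma completely_invariant_half_plane:
  assumes s: "s = 1 \<or> s = -1"
  shows "completely_invariant_Fatou_component (tan_map l) (half_plane s)"
proof -
  have Fatou: "Fatou_set (tan_map l) = half_plane s \<union> half_plane (- s)"
    using s by (auto simp: Fatou_set_tan_map)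
  have disj: "half_plane s \<inter> half_plane (- s) = {}"
    by (auto simp: half_plane_def)
  have "Fin (Complex 0 s) \<in> half_plane s"
    using s by auto
  hence ne: "half_plane s \<noteq> {}"
    by blast
  have comp: "Fatou_component (tan_map l) (half_plane s)"
    unfolding Fatou_component_def in_components_maximal
  proof (intro conjI allI impI)
    fix C assume C: "C \<noteq> {} \<and> half_plane s \<subseteq> C \<and> C \<subseteq> Fatou_set (tan_map l) \<and> connected C"
    \<comment> \<open>The half-planes are disjoint open sets covering \<open>C\<close>, so a
      connected \<open>C\<close> cannot meet both.\<close>
    have "half_plane s \<inter> C = {} \<or> half_plane (- s) \<inter> C = {}"
      by (rule connectedD) (use C open_half_plane disj Fatou in auto)
    thus "C = half_plane s" using C ne Fatou by blast
  qed (use ne Fatou connected_half_plane in auto)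
  \<comment> \<open>Stated for both signs: r = s is forward invariance, and r = -s keeps the
    opposite half-plane out of the preimage of \<open>half_plane s\<close>.\<close>
  have inv: "tan_map l z \<in> half_plane r" if r: "r = 1 \<or> r = -1" "r * Im z > 0" for z r
  proof -
    obtain z' where "tan_map l z = Fin z'" "r * Im z' \<ge> r * Im z + tanh (r * Im z)"
      using tan_map_step[OF r] .
    moreover have "tanh (r * Im z) > 0" using r by simp
    ultimately have "tan_map l z = Fin z'" "r * Im z' > 0" using r(2) by linarith+
    thus ?thesis by simp
  qed
  have "s * Im z > 0" if z: "tan_map l z \<in> half_plane s" for z
  proof (rule ccontr)
    assume "\<not> s * Im z > 0"
    then consider "Im z = 0" | "- s * Im z > 0"
      using s by force
    thus False
    proof cases
      case 1
      \<comment> \<open>A real \<open>z\<close> is sent to a real value or, at a pole, to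
        \<open>Infty\<close>; neither lies in a half-plane.\<close>
      hence "tan z \<in> \<real>" by (intro tan_in_Reals) (simp add: complex_is_Real_iff)
      thus False using z 1 by (auto simp: tan_map_eq complex_is_Real_iff split: if_splits)
    next
      case 2
      hence "tan_map l z \<in> half_plane (- s)" using inv[of "- s" z] s by auto
      thus False using z disj by blast
    qed
  qed
  thus ?thesis
    unfolding completely_invariant_Fatou_component_def invariant_Fatou_component_def
    using comp inv[OF s] by auto
qed

lemma Baker_domain_half_plane:
  assumes s: "s = 1 \<or> s = -1"
  shows "Baker_domain (tan_map l) (half_plane s)"
  using completely_invariant_half_plane[OF s] uniform_limit_half_plane[OF s]
  unfolding Baker_domain_def completely_invariant_Fatou_component_def by blast

lemma Julia_set_tan_map: "Julia_set (tan_map l) = Fin ` \<real> \<union> {Infty}"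
proof (rule set_eqI)
  show "w \<in> Julia_set (tan_map l) \<longleftrightarrow> w \<in> Fin ` \<real> \<union> {Infty}" for w
    by (cases w) (auto simp: Julia_set_def Fatou_set_tan_map complex_is_Real_iff image_iff)
qed

theorem mainTheorem5:
  fixes l :: real
  shows "Fatou_set (tan_map l) = upper_half_plane \<union> lower_half_plane
    \<and> completely_invariant_Fatou_component (tan_map l) upper_half_plane
    \<and> Baker_domain (tan_map l) upper_half_plane
    \<and> completely_invariant_Fatou_component (tan_map l) lower_half_plane
    \<and> Baker_domain (tan_map l) lower_half_plane
    \<and> Julia_set (tan_map l) = Fin ` \<real> \<union> {Infty}"
  unfolding upper_half_plane_eq lower_half_plane_eq
  by (simp add: Fatou_set_tan_map Julia_set_tan_map completely_invariant_half_plane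
      Baker_domain_half_plane)

end
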